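(* Let $A,B,C$ be groups and let $G$ be a subgroup of $A\times B\times C$. (a) The subgroup $G$ is finite cyclic if and only if $\overline{G}_1,\overline{G}_2,\overline{G}_3$ are finite cyclic and each of the pairs of integers $(|G(1|2)|,|G(2|1)|)$, $(|G(1|3)|,|G(3|1)|)$, $(|G(2|3)|,|G(3|2)|)$ is coprime. In this case one also has $|G|=\mathrm{lcm}(|\overline{G}_1|,|\overline{G}_2|,|\overline{G}_3|)$. (b) The subgroup $G$ is infinite cyclic if and only if, up to a permutation of the indices $1,2,3$, one of the following three cases occurs: (i) $\overline{G}_1\cong\mathbb{Z}$, $\overline{G}_2$ and $\overline{G}_3$ are finite cyclic, $G(2|1)=G(3|1)=\{0\}$, and the orders of $G(2|3)$ and $G(3|2)$ are coprime; (ii) $\overline{G}_1\cong\overline{G}_2\cong\mathbb{Z}$, $\overline{G}_3$ is finite cyclic, and $G(2|1)=G(3|1)=G(1|2)=G(3|2)=\{0\}$; (iii) $\overline{G}_i\cong\mathbb{Z}$ for $i=1,2,3$, and $G(i|j)=\{0\}$ for all $1\le i\ne j\le 3$.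
   Context: Write $A_1=A$, $A_2=B$, $A_3=C$. For a subgroup $G\le A_1\times A_2\times A_3$ and $i\in\{1,2,3\}$, $\overline{G}_i$ denotes the projection of $G$ to $A_i$. For $i\ne j$ in $\{1,2,3\}$, $G(i|j)$ denotes the set of $x_i\in A_i$ for which there is an element $(x_1,x_2,x_3)\in G$ with $i$-th coordinate $x_i$ and with $x_j$ the neutral element (the remaining coordinate being arbitrary); it is a normal subgroup of $\overline{G}_i$. Additive notation is used for cyclic groups, so $\{0\}$ denotes the trivial subgroup. The trivial group counts as finite cyclic. *)

theory Defs
  imports "HOL-Algebra.Algebra"
begin

definition finite_cyclic :: "('a, 'm) monoid_scheme \<Rightarrow> bool" where
  "finite_cyclic H \<longleftrightarrow> cyclic_group H \<and> finite (carrier H)"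

definition infinite_cyclic :: "('a, 'm) monoid_scheme \<Rightarrow> bool" where
  "infinite_cyclic H \<longleftrightarrow> cyclic_group H \<and> infinite (carrier H)"

text \<open>
  The three factors of the product may have different carrier types, so an index \<open>i\<close> cannot be a
  number ranging over a common family.  It is represented instead by the pair consisting of the
  \<open>i\<close>-th factor and the projection of the triple product onto it.  The notions below are polymorphic
  in such indices, and permuting \<open>1, 2, 3\<close> amounts to permuting their index arguments.
\<close>

type_synonym ('g, 'x, 'm) coordinate = "('x, 'm) monoid_scheme \<times> ('g \<Rightarrow> 'x)"

definition coord1 :: "('a, 'm) monoid_scheme \<Rightarrow> ('a \<times> 'b \<times> 'c, 'a, 'm) coordinate" where
  "coord1 A = (A, \<lambda>(x, y, z). x)"

definition coord2 :: "('b, 'n) monoid_scheme \<Rightarrow> ('a \<times> 'b \<times> 'c, 'b, 'n) coordinate" where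
  "coord2 B = (B, \<lambda>(x, y, z). y)"

definition coord3 :: "('c, 'k) monoid_scheme \<Rightarrow> ('a \<times> 'b \<times> 'c, 'c, 'k) coordinate" where
  "coord3 C = (C, \<lambda>(x, y, z). z)"

text \<open>\<open>proj_group G i\<close> is the projection of \<open>G\<close> to the \<open>i\<close>-th factor, with the induced group
  structure, and \<open>rel_proj G i j\<close> is \<open>G(i|j)\<close>.\<close>

definition proj_group :: "'g set \<Rightarrow> ('g, 'x, 'm) coordinate \<Rightarrow> ('x, 'm) monoid_scheme" where
  "proj_group G i = (fst i)\<lparr>carrier := snd i ` G\<rparr>"

definition rel_proj ::
    "'g set \<Rightarrow> ('g, 'x, 'm) coordinate \<Rightarrow> ('g, 'y, 'n) coordinate \<Rightarrow> 'x set" where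
  "rel_proj G i j = {snd i g | g. g \<in> G \<and> snd j g = \<one>\<^bsub>fst j\<^esub>}"

definition rel_proj_trivial ::
    "'g set \<Rightarrow> ('g, 'x, 'm) coordinate \<Rightarrow> ('g, 'y, 'n) coordinate \<Rightarrow> bool" where
  "rel_proj_trivial G i j \<longleftrightarrow> rel_proj G i j = {\<one>\<^bsub>fst i\<^esub>}"

definition case_one_infinite ::
    "'g set \<Rightarrow> ('g, 'x, 'm) coordinate \<Rightarrow> ('g, 'y, 'n) coordinate \<Rightarrow> ('g, 'z, 'k) coordinate \<Rightarrow> bool"
  where
  "case_one_infinite G i j k \<longleftrightarrow>
     proj_group G i \<cong> integer_group \<and>
     finite_cyclic (proj_group G j) \<and> finite_cyclic (proj_group G k) \<and>
     rel_proj_trivial G j i \<and> rel_proj_trivial G k i \<and>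
     coprime (card (rel_proj G j k)) (card (rel_proj G k j))"

definition case_two_infinite ::
    "'g set \<Rightarrow> ('g, 'x, 'm) coordinate \<Rightarrow> ('g, 'y, 'n) coordinate \<Rightarrow> ('g, 'z, 'k) coordinate \<Rightarrow> bool"
  where
  "case_two_infinite G i j k \<longleftrightarrow>
     proj_group G i \<cong> integer_group \<and> proj_group G j \<cong> integer_group \<and>
     finite_cyclic (proj_group G k) \<and>
     rel_proj_trivial G j i \<and> rel_proj_trivial G k i \<and>
     rel_proj_trivial G i j \<and> rel_proj_trivial G k j"

definition case_three_infinite ::
    "'g set \<Rightarrow> ('g, 'x, 'm) coordinate \<Rightarrow> ('g, 'y, 'n) coordinate \<Rightarrow> ('g, 'z, 'k) coordinate \<Rightarrow> bool"
  where
  "case_three_infinite G i j k \<longleftrightarrow>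
     proj_group G i \<cong> integer_group \<and> proj_group G j \<cong> integer_group \<and>
     proj_group G k \<cong> integer_group \<and>
     rel_proj_trivial G i j \<and> rel_proj_trivial G j i \<and>
     rel_proj_trivial G i k \<and> rel_proj_trivial G k i \<and>
     rel_proj_trivial G j k \<and> rel_proj_trivial G k j"

definition one_of_three_cases ::
    "'g set \<Rightarrow> ('g, 'x, 'm) coordinate \<Rightarrow> ('g, 'y, 'n) coordinate \<Rightarrow> ('g, 'z, 'k) coordinate \<Rightarrow> bool"
  where
  "one_of_three_cases G i j k \<longleftrightarrow>
     case_one_infinite G i j k \<or> case_two_infinite G i j k \<or> case_three_infinite G i j k"

definition one_of_three_cases_up_to_perm ::
    "'g set \<Rightarrow> ('g, 'x, 'm) coordinate \<Rightarrow> ('g, 'y, 'n) coordinate \<Rightarrow> ('g, 'z, 'k) coordinate \<Rightarrow> bool"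
  where
  "one_of_three_cases_up_to_perm G i j k \<longleftrightarrow>
     one_of_three_cases G i j k \<or> one_of_three_cases G i k j \<or>
     one_of_three_cases G j i k \<or> one_of_three_cases G j k i \<or>
     one_of_three_cases G k i j \<or> one_of_three_cases G k j i"

end

theory Submission
  imports Defs
begin

text \<open>
  The three projections of \<open>G\<close> are homomorphisms whose kernels \<open>K\<^sub>1, K\<^sub>2, K\<^sub>3\<close> intersect trivially,
  and \<open>G(i|j)\<close> is the \<open>i\<close>-th projection of \<open>K\<^sub>j\<close>.  If \<open>G\<close> is generated by \<open>x\<close> and \<open>n\<^sub>i\<close> is the order of
  the \<open>i\<close>-th coordinate of \<open>x\<close> (\<open>0\<close> if infinite), then \<open>K\<^sub>j\<close> is generated by the \<open>n\<^sub>j\<close>-th power of \<open>x\<close>.  Hence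
  \<open>G(i|j)\<close> has order \<open>n\<^sub>i / gcd n\<^sub>i n\<^sub>j\<close> in the finite case and is trivial for \<open>n\<^sub>j = 0\<close>, and \<open>G\<close> is infinite
  iff some \<open>n\<^sub>i\<close> is \<open>0\<close>.  Conversely, each of the cases (i) to (iii) forces \<open>K\<^sub>1\<close> to be trivial.  In the
  finite case, coprimality of \<open>|G(i|j)|\<close> and \<open>|G(j|i)|\<close> makes the \<open>p\<close>-torsions of \<open>K\<^sub>i\<close> and \<open>K\<^sub>j\<close>
  comparable, so every prime \<open>p\<close> fails to divide some \<open>|K\<^sub>i|\<close>.  Therefore \<open>|G|\<close> divides the exponent of the
  abelian group \<open>G\<close>, which is the order of an element.
\<close>

section \<open>Orders of elements\<close>

text \<open>Cauchy's theorem: Sylow gives a subgroup of order \<open>p\<close>, and by Lagrange the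
  \<open>p\<close>-th power of each of its elements is neutral.\<close>

lemma (in group) prime_dvd_order_imp_ord:
  assumes "finite (carrier G)" and p: "Factorial_Ring.prime (p::nat)" "p dvd order G"
  obtains z where "z \<in> carrier G" "z \<noteq> \<one>" "z [^] p = \<one>"
proof -
  obtain m where "order G = p ^ 1 * m"
    using p by auto
  then obtain H where H: "subgroup H G" "card H = p"
    using sylow_thm[OF p(1) is_group] assms(1) by fastforce
  have "\<one> \<in> H"
    using H(1) by (rule subgroup.one_closed)
  moreover have "H \<noteq> {\<one>}"
    using H(2) p(1) by (auto dest: prime_gt_1_nat)
  ultimately obtain z where z: "z \<in> H" "z \<noteq> \<one>"
    by blast
  interpret HG: group "G\<lparr>carrier := H\<rparr>"
    using H(1) by (rule subgroup_imp_group)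
  have "z [^] p = \<one>"
    using HG.pow_order_eq_1[of z] z H by (simp add: order_def flip: nat_pow_consistent)
  then show thesis
    using that z H(1) subgroup.mem_carrier by metis
qed

text \<open>The exponent \<open>ord (a \<otimes> b) * ord b\<close> kills both the product and
  \<open>b\<close>, hence also \<open>a\<close>; coprimality then cancels the factor
  \<open>ord b\<close>.\<close>

lemma (in comm_group) ord_mult_coprime:
  assumes xy: "x \<in> carrier G" "y \<in> carrier G" and cop: "coprime (ord x) (ord y)"
  shows "ord (x \<otimes> y) = ord x * ord y"
proof (rule dvd_antisym)
  show "ord (x \<otimes> y) dvd ord x * ord y"
    using xy by (rule abelian_ord_mul_divides)
  have *: "ord a dvd ord (a \<otimes> b)" if "a \<in> carrier G" "b \<in> carrier G" "coprime (ord a) (ord b)" for a b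
  proof -
    have "(a \<otimes> b) [^] (ord (a \<otimes> b) * ord b) = \<one>"
      using that by (simp add: pow_eq_id)
    moreover have "b [^] (ord (a \<otimes> b) * ord b) = \<one>"
      using that by (simp add: pow_eq_id)
    ultimately have "a [^] (ord (a \<otimes> b) * ord b) = \<one>"
      using that by (simp add: nat_pow_distrib)
    then have "ord a dvd ord (a \<otimes> b) * ord b"
      using that by (simp add: pow_eq_id)
    then show ?thesis
      using that(3) by (simp add: coprime_dvd_mult_left_iff)
  qed
  have "ord x dvd ord (x \<otimes> y)" "ord y dvd ord (x \<otimes> y)"
    using *[of x y] *[of y x] xy cop by (simp_all add: m_comm coprime_commute)
  then show "ord x * ord y dvd ord (x \<otimes> y)"
    using cop by (simp add: divides_mult)
qed

text \<open>An element of maximal order works: if some prime had a larger multiplicity in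
  \<open>ord y\<close>, exchanging the corresponding part of \<open>x\<close> for that of
  \<open>y\<close> would give an element of larger order.\<close>

lemma (in comm_group) exists_ord_exponent:
  assumes fin: "finite (carrier G)"
  obtains x where "x \<in> carrier G" "\<And>y. y \<in> carrier G \<Longrightarrow> ord y dvd ord x"
proof -
  obtain x where x: "x \<in> carrier G" and max: "\<And>y. y \<in> carrier G \<Longrightarrow> ord y \<le> ord x"
  proof -
    have "Max (ord ` carrier G) \<in> ord ` carrier G"
      using fin by (intro Max_in) auto
    then obtain x where x: "x \<in> carrier G" "ord x = Max (ord ` carrier G)"
      by auto
    show thesis
      using fin by (intro that[of x]) (simp_all add: x)
  qed
  have pos: "ord y > 0" if "y \<in> carrier G" for y
    using ord_ge_1[OF fin that] by simp
  have "ord y dvd ord x" if y: "y \<in> carrier G" for y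
  proof (rule multiplicity_le_imp_dvd)
    show "ord y \<noteq> 0"
      using pos[OF y] by simp
  next
    fix p :: nat
    assume p: "Factorial_Ring.prime p"
    define a b where "a = multiplicity p (ord x)" and "b = multiplicity p (ord y)"
    obtain u where u: "ord x = p ^ a * u" "\<not> p dvd u"
      unfolding a_def by (rule multiplicity_decompose'[of "ord x" p]) (use pos[OF x] p in auto)
    obtain v where v: "ord y = p ^ b * v" "\<not> p dvd v"
      unfolding b_def by (rule multiplicity_decompose'[of "ord y" p]) (use pos[OF y] p in auto)
    have nz: "p ^ a \<noteq> 0" "u > 0" "v > 0"
      using p u v by (auto intro!: Nat.gr0I)
    \<comment> \<open>The first power drops the \<open>p\<close>-part of \<open>x\<close>, the
      second keeps only the \<open>p\<close>-part of \<open>y\<close>.\<close>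
    have "ord (x [^] (p ^ a)) = u" "ord (y [^] v) = p ^ b"
      using x y u v nz by (simp_all add: ord_pow)
    moreover have "coprime u (p ^ b)"
      using p u(2) by (metis coprime_commute coprime_power_right_iff prime_imp_coprime)
    ultimately have "ord (x [^] (p ^ a) \<otimes> y [^] v) = u * p ^ b"
      using x y by (simp add: ord_mult_coprime)
    with max[of "x [^] (p ^ a) \<otimes> y [^] v"] x y u nz have "p ^ b \<le> p ^ a"
      by simp
    then show "multiplicity p (ord y) \<le> multiplicity p (ord x)"
      using power_increasing_iff[OF prime_gt_1_nat[OF p]] a_def b_def by simp
  qed
  with x that show thesis
    by blast
qed

section \<open>Cyclic groups\<close>

text \<open>Valid for infinite groups too, where \<open>order\<close> and \<open>ord\<close> are
  both 0 by convention.\<close>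

lemma (in group) order_eq_ord_generator:
  assumes "x \<in> carrier G" "carrier G = range (\<lambda>n::int. x [^] n)"
  shows "order G = ord x"
  using generate_pow_card[OF assms(1)] generate_pow[OF assms(1)] assms(2)
  by (simp add: order_def full_SetCompr_eq)

lemma (in group) finite_iff_ord_generator:
  assumes "x \<in> carrier G" "carrier G = range (\<lambda>n::int. x [^] n)"
  shows "finite (carrier G) \<longleftrightarrow> ord x \<noteq> 0"
  using order_eq_ord_generator[OF assms] order_gt_0_iff_finite by simp

lemma (in group) cyclic_groupI_order_dvd_ord:
  assumes fin: "finite (carrier G)" and x: "x \<in> carrier G" and dvd: "order G dvd ord x"
  shows "cyclic_group G" "order G = ord x"
proof -
  show eq: "order G = ord x"
    using dvd ord_dvd_group_order[OF x] by (simp add: dvd_antisym)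
  have "generate G {x} = carrier G"
    using fin x eq generate_pow_card[OF x] by (intro card_subset_eq) (auto simp: order_def generate_incl)
  then show "cyclic_group G"
    using x generate_pow[OF x] by (auto simp: cyclic_group full_SetCompr_eq)
qed

text \<open>Connects cyclicity with the form in which cases (i) to (iii) are stated; the powers of a
  generator of order 0 are pairwise distinct.\<close>

lemma (in group) infinite_cyclic_iff_iso_integer_group:
  "infinite_cyclic G \<longleftrightarrow> G \<cong> integer_group"
proof
  assume "infinite_cyclic G"
  then obtain x where x: "x \<in> carrier G" and gen: "carrier G = range (\<lambda>n::int. x [^] n)"
    and inf: "infinite (carrier G)"
    by (auto simp: infinite_cyclic_def cyclic_group)
  have "ord x = 0"
    using finite_iff_ord_generator[OF x gen] inf by simp
  then have "inj (\<lambda>n::int. x [^] n)"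
    using x by (auto simp: inj_on_def int_pow_eq)
  then have "(\<lambda>n::int. x [^] n) \<in> iso integer_group G"
    using x gen by (auto simp: iso_def hom_def bij_betw_def int_pow_mult)
  then have "integer_group \<cong> G"
    by (auto simp: is_iso_def)
  then show "G \<cong> integer_group"
    by (simp add: group.iso_sym)
next
  assume iso: "G \<cong> integer_group"
  then have "cyclic_group G"
    using isomorphic_group_cyclicity[OF iso] is_group by simp
  moreover have "infinite (carrier G)"
    using iso by (auto simp: is_iso_def iso_def dest: bij_betw_finite)
  ultimately show "infinite_cyclic G"
    by (simp add: infinite_cyclic_def)
qed

section \<open>Images of homomorphisms\<close>

context group_hom
begin

text \<open>The pair \<open>(H, h)\<close> is read as an index, so that \<open>proj_group\<close>
  and \<open>rel_proj\<close> make sense for arbitrary homomorphisms and not only for coordinates of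
  a product.\<close>

lemma group_proj_group: "group (proj_group (carrier G) (H, h))"
  unfolding proj_group_def using img_is_subgroup H.subgroup_imp_group by simp

lemma epi_proj_group: "h \<in> epi G (proj_group (carrier G) (H, h))"
  using homh by (auto simp: epi_def hom_def proj_group_def)

text \<open>First isomorphism theorem together with Lagrange's theorem for the kernel.\<close>

lemma order_proj_group_mult_kernel:
  "order (proj_group (carrier G) (H, h)) * card (kernel G H h) = order G"
proof -
  let ?P = "proj_group (carrier G) (H, h)"
  interpret P: group_hom G ?P h
    using epi_proj_group group_proj_group
    by (simp add: group_hom_def group_hom_axioms_def epi_def)
  have ker: "kernel G ?P h = kernel G H h"
    by (simp add: kernel_def proj_group_def)
  have "(\<lambda>N. the_elem (h ` N)) \<in> iso (G Mod (kernel G ?P h)) ?P"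
    by (rule P.FactGroup_iso_set) (simp add: proj_group_def)
  then have "card (rcosets (kernel G H h)) = order ?P"
    unfolding ker by (auto simp: iso_def order_def FactGroup_def dest: bij_betw_same_card)
  then show ?thesis
    using G.lagrange[OF subgroup_kernel] by simp
qed

lemma cyclic_proj_group: "cyclic_group G \<Longrightarrow> cyclic_group (proj_group (carrier G) (H, h))"
  by (rule G.cyclic_group_epimorphic_image[OF epi_proj_group _ group_proj_group])

lemma order_proj_group_generator:
  assumes x: "x \<in> carrier G" and gen: "carrier G = range (\<lambda>n::int. x [^] n)"
  shows "order (proj_group (carrier G) (H, h)) = H.ord (h x)"
proof -
  have "h ` carrier G = generate H {h x}"
    using x H.generate_pow[of "h x"] by (simp add: gen image_image hom_int_pow full_SetCompr_eq)
  then show ?thesis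
    using x H.generate_pow_card[of "h x"] by (simp add: proj_group_def order_def)
qed

lemma finite_image_iff_ord_generator:
  assumes x: "x \<in> carrier G" and gen: "carrier G = range (\<lambda>n::int. x [^] n)"
  shows "finite (h ` carrier G) \<longleftrightarrow> H.ord (h x) \<noteq> 0"
proof -
  interpret P: group "proj_group (carrier G) (H, h)"
    by (rule group_proj_group)
  show ?thesis
    using P.order_gt_0_iff_finite unfolding order_proj_group_generator[OF assms]
    by (simp add: proj_group_def)
qed

text \<open>The power \<open>x [^] n\<close> is killed exactly when the order of \<open>h x\<close>
  divides \<open>n\<close>. For order 0 only \<open>n = 0\<close> remains, and the kernel is
  trivial.\<close>

lemma kernel_generator:
  assumes x: "x \<in> carrier G" and gen: "carrier G = range (\<lambda>n::int. x [^] n)"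
  shows "kernel G H h = range (\<lambda>n::int. x [^] (int (H.ord (h x)) * n))"
proof -
  have "h (x [^] n) = \<one>\<^bsub>H\<^esub> \<longleftrightarrow> int (H.ord (h x)) dvd n" for n :: int
    using x by (simp add: hom_int_pow H.int_pow_eq_id)
  then have "kernel G H h = (\<lambda>n::int. x [^] n) ` {n. int (H.ord (h x)) dvd n}"
    unfolding kernel_def gen by auto
  also have "{n. int (H.ord (h x)) dvd n} = range ((*) (int (H.ord (h x))))"
    by (auto simp: dvd_def)
  finally show ?thesis
    by (simp add: image_image)
qed

lemma order_dvd_ord:
  assumes x: "x \<in> carrier G" 
  shows "H.ord (h x) dvd G.ord x"
  using x by (simp flip: H.pow_eq_id hom_nat_pow)

text \<open>Any preimage of a generator of the image serves, since the order of an image divides the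
  order of the element.\<close>

lemma exists_ord_multiple_of_order_proj_group:
  assumes "cyclic_group (proj_group (carrier G) (H, h))"
  obtains x where "x \<in> carrier G" "order (proj_group (carrier G) (H, h)) dvd G.ord x"
proof -
  let ?P = "proj_group (carrier G) (H, h)"
  interpret P: group_hom G ?P h
    using epi_proj_group group_proj_group by (simp add: group_hom_def group_hom_axioms_def epi_def)
  obtain y where y: "y \<in> carrier ?P" and gen: "carrier ?P = range (\<lambda>n::int. y [^]\<^bsub>?P\<^esub> n)"
    using assms by (auto simp: P.H.cyclic_group)
  obtain x where x: "x \<in> carrier G" "y = h x"
    using y by (auto simp: proj_group_def)
  show thesis
    using that[OF x(1)] P.order_dvd_ord[OF x(1)] P.H.order_eq_ord_generator[OF y gen] x(2) by simp
qed

lemma proj_group_generator_cases: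
  assumes x: "x \<in> carrier G" and gen: "carrier G = range (\<lambda>n::int. x [^] n)"
  shows "H.ord (h x) \<noteq> 0 \<Longrightarrow> finite_cyclic (proj_group (carrier G) (H, h))"
    and "H.ord (h x) = 0 \<Longrightarrow> proj_group (carrier G) (H, h) \<cong> integer_group"
proof -
  let ?P = "proj_group (carrier G) (H, h)"
  interpret P: group ?P
    by (rule group_proj_group)
  have cyc: "cyclic_group ?P"
    using x gen G.cyclic_group by (intro cyclic_proj_group) blast
  have fin: "finite (carrier ?P) \<longleftrightarrow> H.ord (h x) \<noteq> 0"
    using finite_image_iff_ord_generator[OF assms] by (simp add: proj_group_def)
  show "finite_cyclic ?P" if "H.ord (h x) \<noteq> 0"
    using that cyc fin by (simp add: finite_cyclic_def)
  show "?P \<cong> integer_group" if "H.ord (h x) = 0"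
    using that cyc fin by (simp add: infinite_cyclic_def flip: P.infinite_cyclic_iff_iso_integer_group)
qed

lemma prime_dvd_card_kernel_imp_torsion:
  assumes "finite (carrier G)" and p: "Factorial_Ring.prime (p::nat)" "p dvd card (kernel G H h)"
  obtains z where "z \<in> kernel G H h" "z \<noteq> \<one>" "z [^] p = \<one>"
proof -
  let ?K = "G\<lparr>carrier := kernel G H h\<rparr>"
  interpret K: group ?K
    using subgroup_kernel by (rule G.subgroup_imp_group)
  have "finite (carrier ?K)"
    using assms(1) by (simp add: kernel_def)
  then obtain z where "z \<in> carrier ?K" "z \<noteq> \<one>\<^bsub>?K\<^esub>" "z [^]\<^bsub>?K\<^esub> p = \<one>\<^bsub>?K\<^esub>"
    using K.prime_dvd_order_imp_ord[of p] p by (auto simp: order_def)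
  then show thesis
    by (intro that[of z]) (auto simp flip: G.nat_pow_consistent)
qed

text \<open>As |G| is the product of the orders of image and kernel, a kernel of order prime to
  \<open>p\<close> leaves the whole \<open>p\<close>-part of |G| in the image.\<close>

lemma multiplicity_order_proj_group:
  assumes "finite (carrier G)" and p: "Factorial_Ring.prime (p::nat)" "\<not> p dvd card (kernel G H h)"
  shows "multiplicity p (order G) = multiplicity p (order (proj_group (carrier G) (H, h)))"
proof -
  let ?n = "order (proj_group (carrier G) (H, h))" and ?k = "card (kernel G H h)"
  have "?n * ?k \<noteq> 0"
    using order_proj_group_mult_kernel G.order_gt_0_iff_finite assms(1) by simp
  then have "multiplicity p (?n * ?k) = multiplicity p ?n + multiplicity p ?k"
    using p(1) by (intro prime_elem_multiplicity_mult_distrib) auto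
  then show ?thesis
    using p(2) by (simp add: order_proj_group_mult_kernel not_dvd_imp_multiplicity_0)
qed

end


section \<open>Relative projections as images of kernels\<close>

lemma rel_proj_eq_image_kernel:
  "rel_proj (carrier G) (B, g) (A, f) = g ` kernel G A f"
  by (auto simp: rel_proj_def kernel_def)

text \<open>The kernel of \<open>f\<close> is generated by the power of \<open>x\<close> whose
  exponent is the order of \<open>f x\<close>; \<open>g\<close> carries this generator over.\<close>

lemma rel_proj_generator:
  assumes f: "group_hom G A f" and g: "group_hom G B g"
    and x: "x \<in> carrier G" and gen: "carrier G = range (\<lambda>n::int. x [^]\<^bsub>G\<^esub> n)"
  shows "rel_proj (carrier G) (B, g) (A, f) = generate B {g x [^]\<^bsub>B\<^esub> group.ord A (f x)}"
proof -
  interpret f: group_hom G A f by (rule f)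
  interpret g: group_hom G B g by (rule g)
  have "(g x [^]\<^bsub>B\<^esub> f.H.ord (f x)) [^]\<^bsub>B\<^esub> n = g (x [^]\<^bsub>G\<^esub> (int (f.H.ord (f x)) * n))" for n :: int
    using x by (simp add: g.hom_int_pow g.H.int_pow_pow flip: int_pow_int)
  then show ?thesis
    unfolding rel_proj_eq_image_kernel f.kernel_generator[OF x gen]
    using x by (simp add: g.H.generate_pow image_image full_SetCompr_eq)
qed

text \<open>If \<open>f x\<close> has order m and \<open>g x\<close> has order n, the two
  cardinalities are m / gcd(m, n) and n / gcd(m, n).\<close>

lemma coprime_card_rel_proj_generator:
  assumes f: "group_hom G A f" and g: "group_hom G B g"
    and x: "x \<in> carrier G" and gen: "carrier G = range (\<lambda>n::int. x [^]\<^bsub>G\<^esub> n)"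
    and nz: "group.ord A (f x) \<noteq> 0" "group.ord B (g x) \<noteq> 0"
  shows "coprime (card (rel_proj (carrier G) (A, f) (B, g))) (card (rel_proj (carrier G) (B, g) (A, f)))"
proof -
  interpret f: group_hom G A f by (rule f)
  interpret g: group_hom G B g by (rule g)
  let ?m = "f.H.ord (f x)" and ?n = "g.H.ord (g x)"
  have "card (rel_proj (carrier G) (A, f) (B, g)) = ?m div gcd ?m ?n"
    using x nz by (simp add: rel_proj_generator[OF g f x gen] f.H.ord_pow_gen flip: f.H.generate_pow_card)
  moreover have "card (rel_proj (carrier G) (B, g) (A, f)) = ?n div gcd ?m ?n"
    using x nz by (simp add: rel_proj_generator[OF f g x gen] g.H.ord_pow_gen gcd.commute flip: g.H.generate_pow_card)
  ultimately show ?thesis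
    using nz by (simp add: div_gcd_coprime)
qed

text \<open>Order 0 makes the generator of the relative projection a zeroth power.\<close>

lemma rel_proj_trivial_generator:
  assumes f: "group_hom G A f" and g: "group_hom G B g"
    and x: "x \<in> carrier G" and gen: "carrier G = range (\<lambda>n::int. x [^]\<^bsub>G\<^esub> n)"
    and "group.ord A (f x) = 0"
  shows "rel_proj_trivial (carrier G) (B, g) (A, f)"
proof -
  interpret g: group_hom G B g by (rule g)
  show ?thesis
    using rel_proj_generator[OF f g x gen] assms(5) g.H.generate_one
    by (simp add: rel_proj_trivial_def)
qed

text \<open>The order of \<open>f z\<close> divides both \<open>p\<close> and the order of the
  relative projection containing \<open>f z\<close>, so it is 1.\<close>

lemma torsion_in_kernel:
  assumes f: "group_hom G A f" and g: "group_hom G B g"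
    and fin: "finite (carrier G)" and p: "Factorial_Ring.prime (p::nat)"
    and ndvd: "\<not> p dvd card (rel_proj (carrier G) (A, f) (B, g))"
    and z: "z \<in> kernel G B g" "z [^]\<^bsub>G\<^esub> p = \<one>\<^bsub>G\<^esub>"
  shows "z \<in> kernel G A f"
proof -
  interpret f: group_hom G A f by (rule f)
  interpret g: group_hom G B g by (rule g)
  let ?R = "rel_proj (carrier G) (A, f) (B, g)"
  have zG: "z \<in> carrier G"
    using z(1) by (simp add: kernel_def)
  have R: "subgroup ?R A"
    unfolding rel_proj_eq_image_kernel using g.subgroup_kernel by (rule f.subgroup_img_is_subgroup)
  then interpret R: group "A\<lparr>carrier := ?R\<rparr>"
    by (rule f.H.subgroup_imp_group)
  have fz: "f z \<in> ?R"
    unfolding rel_proj_eq_image_kernel using z(1) by simp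
  have "f z [^]\<^bsub>A\<^esub> card ?R = \<one>\<^bsub>A\<^esub>"
    using R.pow_order_eq_1[of "f z"] fz by (simp add: order_def flip: f.H.nat_pow_consistent)
  then have "f.H.ord (f z) dvd card ?R"
    using zG by (simp add: f.H.pow_eq_id)
  moreover have "f.H.ord (f z) dvd p"
    using zG z(2) by (simp add: f.H.pow_eq_id[symmetric] flip: f.hom_nat_pow)
  ultimately have "f.H.ord (f z) = 1"
    using p ndvd prime_nat_iff by metis
  then show ?thesis
    using zG f.H.ord_eq_1[of "f z"] by (simp add: kernel_def)
qed

section \<open>Three homomorphisms with trivial joint kernel\<close>

text \<open>Abstracts a subgroup of a triple product to a group with three homomorphisms on an equal
  footing, so that permuting the indices becomes a mere change of locale parameters.\<close>

locale joint_injective = group G + f: group_hom G A f + g: group_hom G B g + h: group_hom G C h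
  for G :: "('g, 'r) monoid_scheme" (structure)
    and A :: "('a, 'm) monoid_scheme" and f
    and B :: "('b, 'n) monoid_scheme" and g
    and C :: "('c, 'k) monoid_scheme" and h +
  assumes joint_kernel: "\<lbrakk>x \<in> carrier G; f x = \<one>\<^bsub>A\<^esub>; g x = \<one>\<^bsub>B\<^esub>; h x = \<one>\<^bsub>C\<^esub>\<rbrakk> \<Longrightarrow> x = \<one>"
begin

text \<open>This cyclic shift and the transposition \<open>swap\<close> generate all six
  permutations of the indices.\<close>

lemma rotate: "joint_injective G B g C h A f"
  by (intro joint_injective.intro joint_injective_axioms.intro is_group
      f.group_hom_axioms g.group_hom_axioms h.group_hom_axioms joint_kernel)

lemma swap: "joint_injective G A f C h B g"
  by (intro joint_injective.intro joint_injective_axioms.intro is_group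
      f.group_hom_axioms g.group_hom_axioms h.group_hom_axioms joint_kernel)

lemma eqI:
  assumes xy: "x \<in> carrier G" "y \<in> carrier G" and "f x = f y" "g x = g y" "h x = h y"
  shows "x = y"
proof -
  have "x \<otimes> inv y = \<one>"
    using assms by (intro joint_kernel) auto
  then show ?thesis
    using xy inv_equality[of x "inv y"] by simp
qed

lemma finite_carrier:
  assumes "finite (f ` carrier G)" "finite (g ` carrier G)" "finite (h ` carrier G)"
  shows "finite (carrier G)"
proof (rule inj_on_finite)
  show "inj_on (\<lambda>x. (f x, g x, h x)) (carrier G)"
    using eqI by (auto simp: inj_on_def)
  show "(\<lambda>x. (f x, g x, h x)) ` carrier G \<subseteq> f ` carrier G \<times> g ` carrier G \<times> h ` carrier G"
    by auto
qed (use assms in simp)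

lemma comm_group_from_proj_groups:
  assumes "comm_group (proj_group (carrier G) (A, f))"
    "comm_group (proj_group (carrier G) (B, g))"
    "comm_group (proj_group (carrier G) (C, h))"
  shows "comm_group G"
proof (rule group_comm_groupI)
  fix x y assume xy: "x \<in> carrier G" "y \<in> carrier G"
  show "x \<otimes> y = y \<otimes> x"
  proof (rule eqI)
    show "f (x \<otimes> y) = f (y \<otimes> x)"
      using comm_groupE(4)[OF assms(1), of "f x" "f y"] xy by (simp add: proj_group_def)
    show "g (x \<otimes> y) = g (y \<otimes> x)"
      using comm_groupE(4)[OF assms(2), of "g x" "g y"] xy by (simp add: proj_group_def)
    show "h (x \<otimes> y) = h (y \<otimes> x)"
      using comm_groupE(4)[OF assms(3), of "h x" "h y"] xy by (simp add: proj_group_def)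
  qed (use xy in auto)
qed

text \<open>Both \<open>g\<close> and \<open>h\<close> vanish on the kernel of \<open>f\<close>,
  which is therefore trivial by \<open>joint_kernel\<close>; so \<open>f\<close> is
  injective.\<close>

lemma iso_proj_groupI:
  assumes "rel_proj_trivial (carrier G) (B, g) (A, f)" "rel_proj_trivial (carrier G) (C, h) (A, f)"
  shows "G \<cong> proj_group (carrier G) (A, f)"
proof -
  have "x = \<one>" if "x \<in> carrier G" "f x = \<one>\<^bsub>A\<^esub>" for x
  proof -
    have "x \<in> kernel G A f"
      using that by (simp add: kernel_def)
    then have "g x = \<one>\<^bsub>B\<^esub>" "h x = \<one>\<^bsub>C\<^esub>"
      using assms unfolding rel_proj_trivial_def rel_proj_eq_image_kernel by auto
    with that show ?thesis
      by (intro joint_kernel)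
  qed
  then have "kernel G A f = {\<one>}"
    by (auto simp: kernel_def)
  then have "inj_on f (carrier G)"
    by (rule f.trivial_ker_imp_inj)
  then have "f \<in> iso G (proj_group (carrier G) (A, f))"
    using f.homh by (auto simp: iso_def hom_def bij_betw_def proj_group_def)
  then show ?thesis
    by (auto simp: is_iso_def)
qed

section \<open>Coprimality, orders and the finite cyclic case\<close>

text \<open>By coprimality \<open>p\<close> misses one of the two orders, and
  \<open>torsion_in_kernel\<close> then gives one inclusion. Arbitrary \<open>f'\<close> and
  \<open>g'\<close> cover all three pairs.\<close>

lemma torsion_kernels_comparable:
  assumes fin: "finite (carrier G)" and p: "Factorial_Ring.prime (p::nat)"
    and f: "group_hom G A' f'" and g: "group_hom G B' g'"
    and cop: "coprime (card (rel_proj (carrier G) (A', f') (B', g'))) (card (rel_proj (carrier G) (B', g') (A', f')))"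
  shows "{z \<in> kernel G A' f'. z [^] p = \<one>} \<subseteq> {z \<in> kernel G B' g'. z [^] p = \<one>} \<or>
    {z \<in> kernel G B' g'. z [^] p = \<one>} \<subseteq> {z \<in> kernel G A' f'. z [^] p = \<one>}"
proof -
  have "\<not> p dvd card (rel_proj (carrier G) (A', f') (B', g')) \<or> \<not> p dvd card (rel_proj (carrier G) (B', g') (A', f'))"
    using cop p by (metis coprime_common_divisor_nat not_prime_1)
  then show ?thesis
    using torsion_in_kernel[OF f g fin p] torsion_in_kernel[OF g f fin p] by blast
qed

definition pairwise_coprime :: bool where
  "pairwise_coprime \<longleftrightarrow>
     coprime (card (rel_proj (carrier G) (A, f) (B, g))) (card (rel_proj (carrier G) (B, g) (A, f))) \<and>
     coprime (card (rel_proj (carrier G) (A, f) (C, h))) (card (rel_proj (carrier G) (C, h) (A, f))) \<and>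
     coprime (card (rel_proj (carrier G) (B, g) (C, h))) (card (rel_proj (carrier G) (C, h) (B, g)))"

text \<open>If \<open>p\<close> divided all three kernel orders, Cauchy would give nontrivial
  \<open>p\<close>-torsion in each kernel; but the smallest of the three torsion sets lies in the
  trivial joint kernel.\<close>

lemma prime_not_dvd_some_kernel:
  assumes fin: "finite (carrier G)" and p: "Factorial_Ring.prime (p::nat)" and cop: pairwise_coprime
  shows "\<not> p dvd card (kernel G A f) \<or> \<not> p dvd card (kernel G B g) \<or> \<not> p dvd card (kernel G C h)"
proof (rule ccontr)
  assume "\<not> ?thesis"
  then have dvd: "p dvd card (kernel G A f)" "p dvd card (kernel G B g)" "p dvd card (kernel G C h)"
    by auto
  let ?S = "{z \<in> kernel G A f. z [^] p = \<one>}" and ?T = "{z \<in> kernel G B g. z [^] p = \<one>}"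
    and ?U = "{z \<in> kernel G C h. z [^] p = \<one>}"
  have "?S \<subseteq> ?T \<or> ?T \<subseteq> ?S" "?S \<subseteq> ?U \<or> ?U \<subseteq> ?S" "?T \<subseteq> ?U \<or> ?U \<subseteq> ?T"
    using cop unfolding pairwise_coprime_def
    by (intro torsion_kernels_comparable[OF fin p] f.group_hom_axioms g.group_hom_axioms h.group_hom_axioms;
        simp)+
  \<comment> \<open>Three pairwise comparable sets have a least one.\<close>
  then have "?S \<subseteq> ?T \<inter> ?U \<or> ?T \<subseteq> ?S \<inter> ?U \<or> ?U \<subseteq> ?S \<inter> ?T"
    by blast
  moreover have "?S \<inter> ?T \<inter> ?U \<subseteq> {\<one>}"
    using joint_kernel by (auto simp: kernel_def)
  moreover have "\<not> ?S \<subseteq> {\<one>}"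
    using f.prime_dvd_card_kernel_imp_torsion[OF fin p dvd(1)] by blast
  moreover have "\<not> ?T \<subseteq> {\<one>}"
    using g.prime_dvd_card_kernel_imp_torsion[OF fin p dvd(2)] by blast
  moreover have "\<not> ?U \<subseteq> {\<one>}"
    using h.prime_dvd_card_kernel_imp_torsion[OF fin p dvd(3)] by blast
  ultimately show False
    by blast
qed

text \<open>A power of \<open>x\<close> is trivial iff its three images are. Infinite order is
  included, since an lcm is 0 iff one of its arguments is 0.\<close>

lemma ord_eq_lcm:
  assumes x: "x \<in> carrier G"
  shows "ord x = lcm (group.ord A (f x)) (lcm (group.ord B (g x)) (group.ord C (h x)))" (is "_ = ?L")
proof (rule dvd_antisym)
  have "x [^] ?L = \<one>"
  proof (rule joint_kernel)
    show "f (x [^] ?L) = \<one>\<^bsub>A\<^esub>"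
      using x by (simp add: f.hom_nat_pow f.H.pow_eq_id)
    show "g (x [^] ?L) = \<one>\<^bsub>B\<^esub>"
      using x by (simp add: g.hom_nat_pow g.H.pow_eq_id)
    show "h (x [^] ?L) = \<one>\<^bsub>C\<^esub>"
      using x by (simp add: h.hom_nat_pow h.H.pow_eq_id)
  qed (use x in simp)
  then show "ord x dvd ?L"
    using x by (simp add: pow_eq_id)
  show "?L dvd ord x"
    using x by (intro lcm_least f.order_dvd_ord g.order_dvd_ord h.order_dvd_ord)
qed

lemma order_eq_lcm:
  assumes "cyclic_group G"
  shows "order G = lcm (order (proj_group (carrier G) (A, f)))
    (lcm (order (proj_group (carrier G) (B, g))) (order (proj_group (carrier G) (C, h))))"
proof -
  obtain x where x: "x \<in> carrier G" and gen: "carrier G = range (\<lambda>n::int. x [^] n)"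
    using assms by (auto simp: cyclic_group)
  show ?thesis
    unfolding f.order_proj_group_generator[OF x gen] g.order_proj_group_generator[OF x gen]
      h.order_proj_group_generator[OF x gen] order_eq_ord_generator[OF x gen]
    using x by (rule ord_eq_lcm)
qed

lemma finite_cyclic_imp:
  assumes "finite_cyclic G"
  shows "finite_cyclic (proj_group (carrier G) (A, f))" "finite_cyclic (proj_group (carrier G) (B, g))"
    "finite_cyclic (proj_group (carrier G) (C, h))" pairwise_coprime
proof -
  obtain x where x: "x \<in> carrier G" and gen: "carrier G = range (\<lambda>n::int. x [^] n)"
    using assms by (auto simp: finite_cyclic_def cyclic_group)
  have nz: "f.H.ord (f x) \<noteq> 0" "g.H.ord (g x) \<noteq> 0" "h.H.ord (h x) \<noteq> 0"
    using assms finite_iff_ord_generator[OF x gen] ord_eq_lcm[OF x] by (auto simp: finite_cyclic_def)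
  show "finite_cyclic (proj_group (carrier G) (A, f))" "finite_cyclic (proj_group (carrier G) (B, g))"
    "finite_cyclic (proj_group (carrier G) (C, h))"
    using nz f.proj_group_generator_cases(1)[OF x gen] g.proj_group_generator_cases(1)[OF x gen]
      h.proj_group_generator_cases(1)[OF x gen] by auto
  show pairwise_coprime
    unfolding pairwise_coprime_def
    by (intro conjI coprime_card_rel_proj_generator[OF _ _ x gen] nz
        f.group_hom_axioms g.group_hom_axioms h.group_hom_axioms)
qed

lemma finite_cyclicI:
  assumes P: "finite_cyclic (proj_group (carrier G) (A, f))" "finite_cyclic (proj_group (carrier G) (B, g))"
    "finite_cyclic (proj_group (carrier G) (C, h))"
    and cop: pairwise_coprime
  shows "finite_cyclic G"
proof -
  let ?l = "order (proj_group (carrier G) (A, f))" and ?m = "order (proj_group (carrier G) (B, g))"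
    and ?n = "order (proj_group (carrier G) (C, h))"
  have fin: "finite (carrier G)"
    using P by (intro finite_carrier) (simp_all add: finite_cyclic_def proj_group_def)
  have cyc: "cyclic_group (proj_group (carrier G) (A, f))" "cyclic_group (proj_group (carrier G) (B, g))"
    "cyclic_group (proj_group (carrier G) (C, h))"
    using P by (simp_all add: finite_cyclic_def)
  \<comment> \<open>Commutativity is what makes the exponent of the group the order of a single
    element \<open>w\<close>.\<close>
  have "comm_group G"
    by (intro comm_group_from_proj_groups group.cyclic_imp_abelian_group f.group_proj_group g.group_proj_group
        h.group_proj_group cyc)
  then interpret comm_group G .
  obtain w where w: "w \<in> carrier G" and exp: "\<And>y. y \<in> carrier G \<Longrightarrow> ord y dvd ord w"
    using exists_ord_exponent[OF fin] by blast
  \<comment> \<open>Lifts of generators of the three images show that the order of \<open>w\<close>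
    is a multiple of each image order.\<close>
  obtain a where a: "a \<in> carrier G" "?l dvd ord a"
    by (rule f.exists_ord_multiple_of_order_proj_group[OF cyc(1)])
  obtain b where b: "b \<in> carrier G" "?m dvd ord b"
    by (rule g.exists_ord_multiple_of_order_proj_group[OF cyc(2)])
  obtain c where c: "c \<in> carrier G" "?n dvd ord c"
    by (rule h.exists_ord_multiple_of_order_proj_group[OF cyc(3)])
  have dvd: "?l dvd ord w" "?m dvd ord w" "?n dvd ord w"
    using a b c exp[of a] exp[of b] exp[of c] by (auto intro: dvd_trans)
  have "order G dvd ord w"
  proof (rule multiplicity_le_imp_dvd)
    show "order G \<noteq> 0"
      using fin order_gt_0_iff_finite by simp
  next
    fix p :: nat assume p: "Factorial_Ring.prime p"
    have "ord w \<noteq> 0"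
      using ord_ge_1[OF fin w] by simp
    then have le: "multiplicity p ?l \<le> multiplicity p (ord w)" "multiplicity p ?m \<le> multiplicity p (ord w)"
      "multiplicity p ?n \<le> multiplicity p (ord w)"
      using dvd by (simp_all add: dvd_imp_multiplicity_le)
    \<comment> \<open>For a projection whose kernel order is prime to \<open>p\<close>, the image
      carries the full \<open>p\<close>-part of |G|, already bounded by that of
      \<open>ord w\<close>.\<close>
    from prime_not_dvd_some_kernel[OF fin p cop] show "multiplicity p (order G) \<le> multiplicity p (ord w)"
      using f.multiplicity_order_proj_group[OF fin p] g.multiplicity_order_proj_group[OF fin p]
        h.multiplicity_order_proj_group[OF fin p] le by auto
  qed
  then show ?thesis
    using cyclic_groupI_order_dvd_ord(1)[OF fin w] fin by (simp add: finite_cyclic_def)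
qed

section \<open>Infinite cyclic groups and the three cases\<close>

lemma infinite_cyclic_imp:
  assumes "infinite_cyclic G"
  shows "one_of_three_cases_up_to_perm (carrier G) (A, f) (B, g) (C, h)"
proof -
  obtain x where x: "x \<in> carrier G" and gen: "carrier G = range (\<lambda>n::int. x [^] n)"
    using assms by (auto simp: infinite_cyclic_def cyclic_group)
  let ?l = "f.H.ord (f x)" and ?m = "g.H.ord (g x)" and ?n = "h.H.ord (h x)"
  have some_zero: "?l = 0 \<or> ?m = 0 \<or> ?n = 0"
    using assms finite_iff_ord_generator[OF x gen] ord_eq_lcm[OF x] by (auto simp: infinite_cyclic_def)
  note homs = f.group_hom_axioms g.group_hom_axioms h.group_hom_axioms
  note proj = f.proj_group_generator_cases[OF x gen] g.proj_group_generator_cases[OF x gen]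
    h.proj_group_generator_cases[OF x gen]
  have f0: "rel_proj_trivial (carrier G) (B, g) (A, f) \<and> rel_proj_trivial (carrier G) (C, h) (A, f)" if "?l = 0"
    using that by (intro conjI rel_proj_trivial_generator[OF _ _ x gen] homs)
  have g0: "rel_proj_trivial (carrier G) (A, f) (B, g) \<and> rel_proj_trivial (carrier G) (C, h) (B, g)" if "?m = 0"
    using that by (intro conjI rel_proj_trivial_generator[OF _ _ x gen] homs)
  have h0: "rel_proj_trivial (carrier G) (A, f) (C, h) \<and> rel_proj_trivial (carrier G) (B, g) (C, h)" if "?n = 0"
    using that by (intro conjI rel_proj_trivial_generator[OF _ _ x gen] homs)
  have cop: "?l \<noteq> 0 \<and> ?m \<noteq> 0 \<Longrightarrow> coprime (card (rel_proj (carrier G) (A, f) (B, g))) (card (rel_proj (carrier G) (B, g) (A, f)))"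
    "?l \<noteq> 0 \<and> ?n \<noteq> 0 \<Longrightarrow> coprime (card (rel_proj (carrier G) (A, f) (C, h))) (card (rel_proj (carrier G) (C, h) (A, f)))"
    "?m \<noteq> 0 \<and> ?n \<noteq> 0 \<Longrightarrow> coprime (card (rel_proj (carrier G) (B, g) (C, h))) (card (rel_proj (carrier G) (C, h) (B, g)))"
    by (intro coprime_card_rel_proj_generator[OF _ _ x gen] homs; simp)+
  note defs = one_of_three_cases_up_to_perm_def one_of_three_cases_def case_one_infinite_def
    case_two_infinite_def case_three_infinite_def
  \<comment> \<open>The number of zeros among \<open>?l\<close>, \<open>?m\<close>,
    \<open>?n\<close> selects case (i), (ii) or (iii), and their positions select the permutation;
    by \<open>some_zero\<close> there is at least one.\<close>
  show ?thesis
    using some_zero proj f0 g0 h0 cop unfolding defs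
    by (cases "?l = 0"; cases "?m = 0"; cases "?n = 0") simp_all
qed

text \<open>The three cases share a core: the first projection is isomorphic to the integers, and
  the relative projections of the other two factors along it are trivial. Hence \<open>f\<close>
  maps \<open>G\<close> isomorphically onto its first projection.\<close>

lemma infinite_cyclicI_three_cases:
  assumes "one_of_three_cases (carrier G) (A, f) (B, g) (C, h)"
  shows "infinite_cyclic G"
proof -
  have "proj_group (carrier G) (A, f) \<cong> integer_group"
    and "rel_proj_trivial (carrier G) (B, g) (A, f)" "rel_proj_trivial (carrier G) (C, h) (A, f)"
    using assms unfolding one_of_three_cases_def case_one_infinite_def case_two_infinite_def
      case_three_infinite_def by blast+
  then have "G \<cong> integer_group"
    using iso_proj_groupI iso_trans by blast
  then show ?thesis
    by (simp add: infinite_cyclic_iff_iso_integer_group)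
qed

lemma infinite_cyclicI:
  assumes "one_of_three_cases_up_to_perm (carrier G) (A, f) (B, g) (C, h)"
  shows "infinite_cyclic G"
proof -
  note ghf = rotate
  note hfg = joint_injective.rotate[OF ghf]
  \<comment> \<open>The six orderings of the three homomorphisms, one for each disjunct of the
    definition.\<close>
  note perms = joint_injective_axioms swap ghf joint_injective.swap[OF ghf] hfg joint_injective.swap[OF hfg]
  from assms show ?thesis
    unfolding one_of_three_cases_up_to_perm_def
    by (elim disjE) (erule joint_injective.infinite_cyclicI_three_cases[rotated], rule perms)+
qed

end

section \<open>Application to subgroups of the direct product\<close>

theorem theorem4p5:
  fixes A :: "('a, 'm) monoid_scheme"
    and B :: "('b, 'n) monoid_scheme"
    and C :: "('c, 'k) monoid_scheme"
    and G :: "('a \<times> 'b \<times> 'c) set"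
  assumes "group A" and "group B" and "group C"
    and "subgroup G (A \<times>\<times> B \<times>\<times> C)"
  shows
    "(finite_cyclic ((A \<times>\<times> B \<times>\<times> C)\<lparr>carrier := G\<rparr>) \<longleftrightarrow>
       finite_cyclic (proj_group G (coord1 A)) \<and>
       finite_cyclic (proj_group G (coord2 B)) \<and>
       finite_cyclic (proj_group G (coord3 C)) \<and>
       coprime (card (rel_proj G (coord1 A) (coord2 B))) (card (rel_proj G (coord2 B) (coord1 A))) \<and>
       coprime (card (rel_proj G (coord1 A) (coord3 C))) (card (rel_proj G (coord3 C) (coord1 A))) \<and>
       coprime (card (rel_proj G (coord2 B) (coord3 C))) (card (rel_proj G (coord3 C) (coord2 B)))) \<and>
     (finite_cyclic ((A \<times>\<times> B \<times>\<times> C)\<lparr>carrier := G\<rparr>) \<longrightarrow>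
       card G = lcm (order (proj_group G (coord1 A)))
                  (lcm (order (proj_group G (coord2 B))) (order (proj_group G (coord3 C))))) \<and>
     (infinite_cyclic ((A \<times>\<times> B \<times>\<times> C)\<lparr>carrier := G\<rparr>) \<longleftrightarrow>
       one_of_three_cases_up_to_perm G (coord1 A) (coord2 B) (coord3 C))"
proof -
  interpret A: group A by fact
  interpret B: group B by fact
  interpret C: group C by fact
  interpret BC: group "B \<times>\<times> C"
    by (intro DirProd_group) fact+
  interpret P: group "A \<times>\<times> B \<times>\<times> C"
    by (intro DirProd_group BC.is_group) fact+
  let ?H = "(A \<times>\<times> B \<times>\<times> C)\<lparr>carrier := G\<rparr>"
  interpret H: group ?H
    using assms(4) by (rule P.subgroup_imp_group)
  have sub: "G \<subseteq> carrier A \<times> carrier B \<times> carrier C"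
    using subgroup.subset[OF assms(4)] by simp
  \<comment> \<open>The joint kernel is trivial because a triple with three neutral coordinates is
    the neutral element.\<close>
  interpret joint_injective ?H A "\<lambda>(x, y, z). x" B "\<lambda>(x, y, z). y" C "\<lambda>(x, y, z). z"
  proof unfold_locales
    show "(\<lambda>(x, y, z). x) \<in> hom ?H A" "(\<lambda>(x, y, z). y) \<in> hom ?H B" "(\<lambda>(x, y, z). z) \<in> hom ?H C"
      using sub by (auto simp: hom_def)
  qed auto
  have carrier_H: "carrier ?H = G"
    by simp
  show ?thesis
    using finite_cyclic_imp finite_cyclicI order_eq_lcm infinite_cyclic_imp infinite_cyclicI
    unfolding coord1_def coord2_def coord3_def pairwise_coprime_def carrier_H
    \<comment> \<open>Unfolding only at \<open>?H\<close> leaves the projections folded, exposes the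
      premise \<open>cyclic_group ?H\<close> of \<open>order_eq_lcm\<close>, and turns
      \<open>order ?H\<close> into \<open>card G\<close>.\<close>
    unfolding finite_cyclic_def[of ?H] order_def[of ?H] carrier_H
    by blast
qed

end
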